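(* Let $G$ be a finite group with a Hall subgroup $H$ of order $n$. Let $\pi$ be the set of prime divisors of $n$, and for a $\pi$-element $x\in G$ let $\lambda_G(x)$ denote the number of Hall $\pi$-subgroups of $G$ containing $x$. Then \[\frac{1}{n^2}\sum_{d\,\mid\, n}\mu(d)\sum_{h\in H}\lambda_G(h^d)^{\frac{n}{d}}\] is a non-negative integer, where $d$ runs over the positive divisors of $n$ and $\mu$ is the (number-theoretic) Möbius function. Moreover, this integer is zero if and only if $H\ne 1$ and $H$ is normal in $G$.
   Context: A Hall subgroup of a finite group $G$ is a subgroup $H$ such that $|H|$ and $|G:H|$ are coprime. For a set of primes $\pi$, a Hall $\pi$-subgroup of $G$ is a subgroup whose order is divisible only by primes in $\pi$ and whose index is divisible by no prime in $\pi$; when $\pi$ is the set of prime divisors of $n=|H|$ with $H$ a Hall subgroup, the Hall $\pi$-subgroups of $G$ are exactly the subgroups of $G$ of order $n$. A $\pi$-element is an element whose order is divisible only by primes in $\pi$. It is not assumed that the Hall $\pi$-subgroups of $G$ are conjugate in $G$. *)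

theory Defs
  imports
    Complex_Main
    "HOL-Algebra.Coset"
    "HOL-Computational_Algebra.Squarefree"
begin

definition moebius_mu :: "nat \<Rightarrow> int" where
  "moebius_mu n = (if squarefree n then (- 1) ^ card (prime_factors n) else 0)"

definition hall_subgroup :: "('a, 'b) monoid_scheme \<Rightarrow> 'a set \<Rightarrow> bool" where
  "hall_subgroup G H \<longleftrightarrow>
     subgroup H G \<and> coprime (card H) (card (rcosets\<^bsub>G\<^esub> H))"

definition hall_pi_subgroup :: "('a, 'b) monoid_scheme \<Rightarrow> nat set \<Rightarrow> 'a set \<Rightarrow> bool" where
  "hall_pi_subgroup G \<pi> K \<longleftrightarrow>
     subgroup K G \<and>
     (\<forall>p. prime p \<and> p dvd card K \<longrightarrow> p \<in> \<pi>) \<and>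
     (\<forall>p\<in>\<pi>. prime p \<longrightarrow> \<not> p dvd card (rcosets\<^bsub>G\<^esub> K))"

text \<open>
  The following function is total on the carrier type; it is only meant to be applied to
  elements whose order is divisible only by primes in \<open>\<pi>\<close>.  If \<open>\<pi>\<close> is the set of prime
  divisors of the order of a finite subgroup, every element of that subgroup is of this kind.
\<close>

definition hall_count :: "('a, 'b) monoid_scheme \<Rightarrow> nat set \<Rightarrow> 'a \<Rightarrow> nat" where
  "hall_count G \<pi> x = card {K. hall_pi_subgroup G \<pi> K \<and> x \<in> K}"

end

theory Submission
  imports
    Defs
    "HOL-Algebra.Zassenhaus"
    "HOL-Algebra.Multiplicative_Group"
    "HOL-Algebra.Elementary_Groups"
begin

text \<open>
  Let \<open>\<Omega>\<close> be the set of Hall \<open>\<pi>\<close>-subgroups, on which \<open>H\<close> acts by conjugation. A \<open>\<pi>\<close>-element that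
  normalizes a Hall \<open>\<pi>\<close>-subgroup lies in it, so \<open>\<lambda>(x)\<close> is the number of fixed points of \<open>x\<close>.
  Let \<open>H \<times> C\<close>, where \<open>C\<close> is the group of integers modulo \<open>n\<close>, act on words of length \<open>n\<close> over \<open>\<Omega>\<close>: the
  first factor letterwise, the second by rotation. If \<open>c\<close> has order \<open>d\<close>, then \<open>(h, c)\<close> fixes exactly
  \<open>\<lambda>(h\<^sup>d)\<close> to the power \<open>n/d\<close> words. Counting pairs of a group element and a fixed word the other way
  round, the weights \<open>\<mu>(d)\<close> cancel the contribution of every word except the primitive ones, whose
  stabilizer projects trivially to \<open>C\<close>. Primitive words form a union of orbits of a group of order
  \<open>n\<^sup>2\<close>, and the stabilizers along an orbit have total size \<open>n\<^sup>2\<close>; so the quotient is the number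
  of orbits of primitive words. If \<open>K \<noteq> H\<close> is a conjugate of \<open>H\<close>, the word \<open>H K K \<dots> K\<close> is primitive;
  if \<open>H\<close> is normal, \<open>\<Omega>\<close> is a singleton and the only word is constant.
\<close>

section \<open>The divisor sum of the Moebius function\<close>

text \<open>A new prime adds one prime factor to a squarefree number and keeps it squarefree;
  otherwise both sides vanish.\<close>

lemma moebius_mu_prime_mult:
  assumes "prime p" "\<not> p dvd d"
  shows "moebius_mu (p * d) = - moebius_mu d"
proof (cases "squarefree d")
  case False
  then show ?thesis
    using squarefree_multD(2)[of p d] by (auto simp: moebius_mu_def)
next
  case True
  have "coprime p d"
    using assms by (simp add: prime_imp_coprime)
  moreover have "d \<noteq> 0" "p \<noteq> 0"
    using assms by (metis dvd_0_right, auto)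
  moreover have "prime_factors (p * d) = insert p (prime_factors d)"
    using assms \<open>d \<noteq> 0\<close> \<open>p \<noteq> 0\<close> by (simp add: prime_factors_product prime_prime_factors)
  moreover have "p \<notin> prime_factors d"
    using assms by auto
  ultimately show ?thesis
    using True assms squarefree_mult_coprime[of p d] by (simp add: moebius_mu_def squarefree_prime)
qed

text \<open>Only squarefree divisors count. For a fixed prime \<open>p\<close> dividing
  \<open>m\<close>, multiplication by \<open>p\<close> matches those prime to \<open>p\<close>
  (\<open>A\<close>) with those divisible by \<open>p\<close> (\<open>B\<close>) and reverses the
  sign.\<close>

lemma sum_moebius_mu_divisors:
  assumes "m > 0"
  shows "(\<Sum>d | d dvd m. moebius_mu d) = (if m = 1 then 1 else 0)"
proof (cases "m = 1")
  case True
  then show ?thesis by (simp add: moebius_mu_def)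
next
  case False
  then obtain p where p: "prime p" "p dvd m"
    using prime_factor_nat by blast
  define A where "A = {d. d dvd m \<and> squarefree d \<and> \<not> p dvd d}"
  define B where "B = {d. d dvd m \<and> squarefree d \<and> p dvd d}"
  have fin: "finite {d. d dvd m}"
    using assms by simp
  have finAB: "finite A" "finite B"
    unfolding A_def B_def by (auto intro: finite_subset[OF _ fin])
  have B: "B = (*) p ` A"
  proof (intro equalityI subsetI)
    fix x assume "x \<in> B"
    then obtain d where d: "x = p * d" "x dvd m" "squarefree x"
      unfolding B_def by blast
    have "\<not> p dvd d"
    proof
      assume "p dvd d"
      then have "p ^ 2 dvd x"
        using d by (simp add: power2_eq_square)
      then show False
        using squarefreeD[OF d(3), of p] p(1) not_prime_unit by blast
    qed
    moreover have "d dvd m" "squarefree d"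
      using d dvd_mult_right[of p d m] squarefree_multD(2)[of p d] by simp_all
    ultimately have "d \<in> A"
      by (simp add: A_def)
    then show "x \<in> (*) p ` A" using d by blast
  next
    fix x assume "x \<in> (*) p ` A"
    then obtain d where d: "x = p * d" "d dvd m" "squarefree d" "\<not> p dvd d"
      by (auto simp: A_def)
    have "coprime p d"
      using p d by (simp add: prime_imp_coprime)
    then show "x \<in> B"
      using d p squarefree_mult_coprime[of p d] squarefree_prime[of p] divides_mult[of p m d]
      by (simp add: B_def)
  qed
  have inj: "inj_on ((*) p) A"
    using p by (auto simp: inj_on_def)
  have "(\<Sum>d | d dvd m. moebius_mu d) = (\<Sum>d\<in>A \<union> B. moebius_mu d)"
    by (rule sum.mono_neutral_right[OF fin]) (auto simp: A_def B_def moebius_mu_def)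
  also have "\<dots> = (\<Sum>d\<in>A. moebius_mu d) + (\<Sum>d\<in>B. moebius_mu d)"
    by (rule sum.union_disjoint[OF finAB]) (auto simp: A_def B_def)
  also have "(\<Sum>d\<in>B. moebius_mu d) = (\<Sum>d\<in>A. - moebius_mu d)"
    unfolding B sum.reindex[OF inj] o_def
    by (rule sum.cong) (auto simp: A_def moebius_mu_prime_mult p)
  finally show ?thesis
    using False by (simp add: sum_negf)
qed

section \<open>Words over a set with a group action\<close>

text \<open>Bijectivity of \<open>\<phi> g\<close> follows from the action laws, with
  \<open>\<phi> (inv g)\<close> as inverse; extensionality is assumed because \<open>Bij E\<close>
  consists of extensional maps.\<close>

lemma group_actionI:
  fixes G (structure)
  assumes "group G"
    and "\<And>g x. g \<in> carrier G \<Longrightarrow> x \<in> E \<Longrightarrow> \<phi> g x \<in> E"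
    and "\<And>g. g \<in> carrier G \<Longrightarrow> \<phi> g \<in> extensional E"
    and one: "\<And>x. x \<in> E \<Longrightarrow> \<phi> \<one>\<^bsub>G\<^esub> x = x"
    and mult: "\<And>g h x. g \<in> carrier G \<Longrightarrow> h \<in> carrier G \<Longrightarrow> x \<in> E \<Longrightarrow> \<phi> (g \<otimes>\<^bsub>G\<^esub> h) x = \<phi> g (\<phi> h x)"
  shows "group_action G E \<phi>"
proof -
  interpret group G by fact
  have Bij: "\<phi> g \<in> Bij E" if "g \<in> carrier G" for g
  proof -
    have "\<phi> g (\<phi> (inv g) x) = x" "\<phi> (inv g) (\<phi> g x) = x" if "x \<in> E" for x
      using that \<open>g \<in> carrier G\<close> by (simp_all flip: mult add: one)
    then have "bij_betw (\<phi> g) E E"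
      using assms(2) that by (intro bij_betw_byWitness[where f' = "\<phi> (inv g)"]) auto
    then show ?thesis
      using assms(3) that by (simp add: Bij_def)
  qed
  have "\<phi> \<in> hom G (BijGroup E)"
  proof (rule homI)
    show "\<phi> g \<in> carrier (BijGroup E)" if "g \<in> carrier G" for g
      using Bij that by (simp add: BijGroup_def)
    show "\<phi> (g \<otimes> h) = \<phi> g \<otimes>\<^bsub>BijGroup E\<^esub> \<phi> h" if "g \<in> carrier G" "h \<in> carrier G" for g h
    proof -
      have "\<phi> (g \<otimes> h) = compose E (\<phi> g) (\<phi> h)"
        using assms(3)[of "g \<otimes> h"] that by (intro extensionalityI[of _ E]) (auto simp: mult compose_def)
      then show ?thesis
        using Bij that by (simp add: BijGroup_def)
    qed
  qed
  then show ?thesis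
    by (simp add: group_action_def group_hom_def group_hom_axioms_def group_BijGroup assms(1))
qed

text \<open>By orbit-stabilizer, the stabilizer orders along one orbit add up to the group order,
  and \<open>F\<close>, being closed under the action, is a union of orbits.\<close>

lemma (in group_action) order_dvd_sum_card_stabilizer:
  assumes "finite (carrier G)" "finite E" "F \<subseteq> E"
    and closed: "\<And>g x. g \<in> carrier G \<Longrightarrow> x \<in> F \<Longrightarrow> \<phi> g x \<in> F"
  shows "order G dvd (\<Sum>x\<in>F. card (stabilizer G \<phi> x))"
proof -
  \<comment> \<open>Extension by zero turns the sum over \<open>F\<close> into one over
    \<open>E\<close>, which the orbits partition.\<close>
  let ?f = "\<lambda>x. if x \<in> F then card (stabilizer G \<phi> x) else 0"
  have "(\<Sum>x\<in>F. card (stabilizer G \<phi> x)) = (\<Sum>x\<in>E. ?f x)"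
    using assms(2,3) by (simp add: sum.If_cases Int_absorb1)
  also have "\<dots> = (\<Sum>orb\<in>orbits G E \<phi>. \<Sum>x\<in>orb. ?f x)"
    using disjoint_sum[OF assms(2), of ?f] by simp
  also have "order G dvd \<dots>"
  proof (rule dvd_sum)
    fix orb assume orb: "orb \<in> orbits G E \<phi>"
    show "order G dvd (\<Sum>x\<in>orb. ?f x)"
    proof (cases "orb \<inter> F = {}")
      case True
      then have "(\<Sum>x\<in>orb. ?f x) = 0"
        by (intro sum.neutral) auto
      then show ?thesis by simp
    next
      case False
      then obtain x where x: "x \<in> orb" "x \<in> F" by blast
      have "x \<in> E" using x assms(3) by blast
      have "orbit G \<phi> x = orb"
        using disjoint_union[OF orb, of "orbit G \<phi> x"] orbit_refl[OF \<open>x \<in> E\<close>] x \<open>x \<in> E\<close>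
        by (auto simp: orbits_def)
      then have "orb \<subseteq> F"
        using closed x by (auto simp: orbit_def)
      then have "(\<Sum>x\<in>orb. ?f x) = (\<Sum>x\<in>orb. card (stabilizer G \<phi> x))"
        by (intro sum.cong) auto
      then show ?thesis
        using card_stablizer_sum[OF assms(1) orb] by simp
    qed
  qed
  finally show ?thesis .
qed

text \<open>
  The residue \<open>n/d\<close> has order \<open>d\<close>; the reduction modulo \<open>n\<close> only matters for \<open>d = 1\<close>. The integers
  whose residue lies in the projection of \<open>S\<close> are the multiples of some \<open>g\<close> dividing \<open>n\<close>, so that
  the sum reduces to the divisors of \<open>n/g\<close>.
\<close>

lemma sum_moebius_mu_subgroup_DirProd:
  assumes "group G" "n > 0" and S: "subgroup S (G \<times>\<times> integer_mod_group n)"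
  shows "(\<Sum>d | d dvd n. moebius_mu d * int (card {h. (h, int (n div d) mod int n) \<in> S})) =
    (if \<forall>(h, c)\<in>S. c = 0 then int (card S) else 0)"
proof -
  interpret G: group G by fact
  interpret P: group "G \<times>\<times> integer_mod_group n"
    by (simp add: DirProd_group assms(1))
  interpret S: subgroup S "G \<times>\<times> integer_mod_group n" by fact
  have carr: "h \<in> carrier G" "0 \<le> c" "c < int n" if "(h, c) \<in> S" for h c
    using S.mem_carrier[OF that] assms(2) by (auto simp: carrier_integer_mod_group)
  have mult: "(h \<otimes>\<^bsub>G\<^esub> h', (c + c') mod int n) \<in> S" if "(h, c) \<in> S" "(h', c') \<in> S" for h h' c c'
    using S.m_closed[OF that] by simp
  have inv: "(inv\<^bsub>G\<^esub> h, (- c) mod int n) \<in> S" if "(h, c) \<in> S" for h c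
    using S.m_inv_closed[OF that] S.mem_carrier[OF that] by (simp add: assms(1))
  have one: "(\<one>\<^bsub>G\<^esub>, 0) \<in> S"
    using S.one_closed by simp
  define T where "T = {t. \<exists>h. (h, t mod int n) \<in> S}"
  have T_diff: "s - t \<in> T" if st: "s \<in> T" "t \<in> T" for s t
  proof -
    obtain h k where hk: "(h, s mod int n) \<in> S" "(k, t mod int n) \<in> S"
      using st by (auto simp: T_def)
    have "(h \<otimes>\<^bsub>G\<^esub> inv\<^bsub>G\<^esub> k, (s - t) mod int n) \<in> S"
      using mult[OF hk(1) inv[OF hk(2)]] by (simp add: mod_simps)
    then show ?thesis by (auto simp: T_def)
  qed
  have T_0: "0 \<in> T" and T_n: "int n \<in> T"
    using one by (auto simp: T_def)
  have T_add: "s + t \<in> T" if "s \<in> T" "t \<in> T" for s t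
    using T_diff[OF that(1) T_diff[OF T_0 that(2)]] by simp
  have T_mult: "int k * t \<in> T" if "t \<in> T" for k t
    by (induction k) (auto simp: T_0 T_add that algebra_simps)
  \<comment> \<open>\<open>T\<close> is a subgroup of the integers containing \<open>n\<close>,
    hence generated by its least positive element.\<close>
  define g where "g = (LEAST k. k > 0 \<and> int k \<in> T)"
  have g: "g > 0" "int g \<in> T"
    using LeastI[of "\<lambda>k. k > 0 \<and> int k \<in> T" n] T_n assms(2) by (auto simp: g_def)
  have T_iff: "int k \<in> T \<longleftrightarrow> g dvd k" for k
  proof
    assume "int k \<in> T"
    \<comment> \<open>The remainder of \<open>k\<close> modulo \<open>g\<close> lies in
      \<open>T\<close> and is smaller than \<open>g\<close>, so minimality makes it 0.\<close>
    then have "int k - int (k div g) * int g \<in> T"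
      by (intro T_diff T_mult g)
    also have "int k - int (k div g) * int g = int (k mod g)"
      by (simp add: minus_div_mult_eq_mod of_nat_div of_nat_mod)
    finally have "\<not> 0 < k mod g"
      using not_less_Least[of "k mod g" "\<lambda>k. k > 0 \<and> int k \<in> T"] g(1)
      by (auto simp: g_def[symmetric])
    then show "g dvd k" by auto
  next
    assume "g dvd k"
    then show "int k \<in> T"
      using T_mult[OF g(2)] by (auto elim!: dvdE simp: mult.commute)
  qed
  have "g dvd n" using T_n T_iff by blast
  \<comment> \<open>Both sides say that \<open>d * g\<close> divides \<open>n\<close>.\<close>
  have g_dvd_iff: "g dvd n div d \<longleftrightarrow> d dvd n div g" if "d dvd n" for d
    using that \<open>g dvd n\<close> assms(2) g(1)
    by (subst (1 2) dvd_div_iff_mult) (auto simp: mult.commute)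
  define s where "s = card {h. (h, 0) \<in> S}"
  have card_eq: "card {h. (h, int (n div d) mod int n) \<in> S} = (if d dvd n div g then s else 0)"
    if "d dvd n" for d
  proof (cases "d dvd n div g")
    case False
    then have "int (n div d) \<notin> T"
      using T_iff g_dvd_iff[OF that] by blast
    then show ?thesis using False by (simp add: T_def)
  next
    case True
    then have "int (n div d) \<in> T"
      using T_iff g_dvd_iff[OF that] by blast
    then obtain k where k: "(k, int (n div d) mod int n) \<in> S"
      by (auto simp: T_def)
    have kG: "k \<in> carrier G" using carr[OF k] by blast
    \<comment> \<open>The nonempty fibres of \<open>S\<close> over the cyclic factor are translates
      of the fibre over 0, so each has \<open>s\<close> elements.\<close>
    have "{h. (h, int (n div d) mod int n) \<in> S} = (\<lambda>h. h \<otimes>\<^bsub>G\<^esub> k) ` {h. (h, 0) \<in> S}"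
    proof (intro equalityI subsetI)
      fix h assume "h \<in> {h. (h, int (n div d) mod int n) \<in> S}"
      then have h: "(h, int (n div d) mod int n) \<in> S" by simp
      have "(h \<otimes>\<^bsub>G\<^esub> inv\<^bsub>G\<^esub> k, 0) \<in> S"
        using mult[OF h inv[OF k]] by (simp add: mod_simps)
      moreover have "h = h \<otimes>\<^bsub>G\<^esub> inv\<^bsub>G\<^esub> k \<otimes>\<^bsub>G\<^esub> k"
        using carr[OF h] kG by (simp add: G.m_assoc)
      ultimately show "h \<in> (\<lambda>h. h \<otimes>\<^bsub>G\<^esub> k) ` {h. (h, 0) \<in> S}" by blast
    next
      fix h assume "h \<in> (\<lambda>h. h \<otimes>\<^bsub>G\<^esub> k) ` {h. (h, 0) \<in> S}"
      then show "h \<in> {h. (h, int (n div d) mod int n) \<in> S}"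
        using mult[OF _ k] by fastforce
    qed
    moreover have "inj_on (\<lambda>h. h \<otimes>\<^bsub>G\<^esub> k) {h. (h, 0) \<in> S}"
      using carr(1) kG by (auto intro!: inj_onI)
    ultimately show ?thesis
      using True by (simp add: card_image s_def)
  qed
  have "n div g dvd n"
    using \<open>g dvd n\<close> by auto
  have "n div g > 0"
    using assms(2) \<open>g dvd n\<close> by (simp add: dvd_imp_le g(1) div_greater_zero_iff)
  have "(\<Sum>d | d dvd n. moebius_mu d * int (card {h. (h, int (n div d) mod int n) \<in> S})) =
    (\<Sum>d | d dvd n. if d dvd n div g then moebius_mu d * int s else 0)"
    by (rule sum.cong) (simp_all add: card_eq)
  also have "\<dots> = (\<Sum>d | d dvd n \<and> d dvd n div g. moebius_mu d * int s)"
    using sum.inter_filter[of "{d. d dvd n}" "\<lambda>d. moebius_mu d * int s" "\<lambda>d. d dvd n div g"] assms(2)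
    by simp
  also have "{d. d dvd n \<and> d dvd n div g} = {d. d dvd n div g}"
    using dvd_trans[OF _ \<open>n div g dvd n\<close>] by blast
  also have "(\<Sum>d | d dvd n div g. moebius_mu d * int s) = (if n div g = 1 then int s else 0)"
    by (simp add: sum_moebius_mu_divisors[OF \<open>n div g > 0\<close>] flip: sum_distrib_right)
  \<comment> \<open>In the surviving case \<open>g = n\<close>, the natural numbers in
    \<open>T\<close> are the multiples of \<open>n\<close>, so \<open>S\<close> projects trivially
    to the cyclic factor.\<close>
  also have "n div g = 1 \<longleftrightarrow> g = n"
    using \<open>g dvd n\<close> g(1) by (auto elim!: dvdE)
  also have "g = n \<longleftrightarrow> (\<forall>(h, c)\<in>S. c = 0)"
  proof
    assume "g = n"
    show "\<forall>(h, c)\<in>S. c = 0"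
    proof safe
      fix h c assume hc: "(h, c) \<in> S"
      then have "int (nat c) \<in> T"
        using carr[OF hc] by (auto simp: T_def)
      then have "n dvd nat c" using T_iff \<open>g = n\<close> by blast
      then show "c = 0"
        using carr[OF hc] nat_dvd_not_less[of "nat c" n] by (cases "c = 0") (auto simp: nat_less_iff)
    qed
  next
    assume "\<forall>(h, c)\<in>S. c = 0"
    then have "int g mod int n = 0"
      using g(2) by (auto simp: T_def)
    then have "n dvd g" by presburger
    then show "g = n" using \<open>g dvd n\<close> dvd_antisym by blast
  qed
  also have "(if \<forall>(h, c)\<in>S. c = 0 then int s else 0) = (if \<forall>(h, c)\<in>S. c = 0 then int (card S) else 0)"
  proof (cases "\<forall>(h, c)\<in>S. c = 0")
    case True
    then have "S = (\<lambda>h. (h, 0)) ` {h. (h, 0) \<in> S}" by auto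
    moreover have "card ((\<lambda>h. (h, 0 :: int)) ` {h. (h, 0) \<in> S}) = s"
      by (simp add: s_def card_image inj_on_def)
    ultimately have "card S = s" by metis
    then show ?thesis by simp
  next
    case False
    then show ?thesis by (simp only: if_False)
  qed
  finally show ?thesis .
qed

text \<open>Positions are integers so that \<open>i - c\<close> is not truncated and matches the
  addition of \<open>integer_mod_group n\<close>. The bounded abstraction keeps the result
  extensional, as \<open>words n E\<close> demands.\<close>

definition twist_act :: "('a \<Rightarrow> 'b \<Rightarrow> 'b) \<Rightarrow> nat \<Rightarrow> 'a \<times> int \<Rightarrow> (int \<Rightarrow> 'b) \<Rightarrow> int \<Rightarrow> 'b"
  where "twist_act \<phi> n = (\<lambda>(g, c) w. \<lambda>i\<in>{0..<int n}. \<phi> g (w ((i - c) mod int n)))"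

abbreviation words :: "nat \<Rightarrow> 'b set \<Rightarrow> (int \<Rightarrow> 'b) set"
  where "words n E \<equiv> {0..<int n} \<rightarrow>\<^sub>E E"

section \<open>The action of \<open>G \<times>\<times> integer_mod_group n\<close> on words and its
  fixed words\<close>

context group_action
begin

lemma act_closed: "g \<in> carrier G \<Longrightarrow> x \<in> E \<Longrightarrow> \<phi> g x \<in> E"
  using element_image by blast

lemma act_one: "x \<in> E \<Longrightarrow> \<phi> \<one> x = x"
  by (simp flip: id_eq_one)

lemma twist_act_closed:
  assumes "n > 0" "g \<in> carrier G" "w \<in> words n E"
  shows "twist_act \<phi> n (g, c) w \<in> words n E"
  using assms unfolding twist_act_def
  by (auto simp: restrict_PiE_iff intro!: act_closed[OF assms(2)] PiE_mem[OF assms(3)])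

text \<open>Rotation commutes with the letterwise action, so together they give an action of the
  direct product. The maps are restricted to \<open>words n E\<close> because
  \<open>group_action\<close> asks for extensional ones.\<close>

lemma twist_act_action:
  assumes "n > 0"
  shows "group_action (G \<times>\<times> integer_mod_group n) (words n E)
    (\<lambda>gc. restrict (twist_act \<phi> n gc) (words n E))"
proof (rule group_actionI)
  interpret group G
    using group_hom group_hom.axioms(1) by auto
  show "group (G \<times>\<times> integer_mod_group n)"
    by (simp add: DirProd_group)
  fix gc w assume gc: "gc \<in> carrier (G \<times>\<times> integer_mod_group n)" and w: "w \<in> words n E"
  obtain g c where [simp]: "gc = (g, c)" and g: "g \<in> carrier G"
    using gc by (auto simp: carrier_DirProd)
  show "restrict (twist_act \<phi> n gc) (words n E) w \<in> words n E"
    using w twist_act_closed[OF assms g w] by simp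
next
  interpret group G
    using group_hom group_hom.axioms(1) by auto
  fix w assume w: "w \<in> words n E"
  have "twist_act \<phi> n (\<one>, 0) w = w"
    using w by (intro extensionalityI[of _ "{0..<int n}"])
      (auto simp: twist_act_def act_one PiE_def Pi_def)
  then show "restrict (twist_act \<phi> n \<one>\<^bsub>G \<times>\<times> integer_mod_group n\<^esub>) (words n E) w = w"
    using w by simp
next
  interpret group G
    using group_hom group_hom.axioms(1) by auto
  fix gc hd w assume gc: "gc \<in> carrier (G \<times>\<times> integer_mod_group n)"
    and hd: "hd \<in> carrier (G \<times>\<times> integer_mod_group n)" and w: "w \<in> words n E"
  obtain g c h d where [simp]: "gc = (g, c)" "hd = (h, d)"
    and g: "g \<in> carrier G" and h: "h \<in> carrier G"
    using gc hd by (auto simp: carrier_DirProd)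
  have "twist_act \<phi> n hd w \<in> words n E"
    using twist_act_closed[OF assms h w] by simp
  moreover have "twist_act \<phi> n (g \<otimes> h, (c + d) mod int n) w = twist_act \<phi> n gc (twist_act \<phi> n hd w)"
  proof (rule extensionalityI[of _ "{0..<int n}"])
    fix i assume i: "i \<in> {0..<int n}"
    have "w ((i - (c + d)) mod int n) \<in> E"
      using assms by (intro PiE_mem[OF w]) auto
    then show "twist_act \<phi> n (g \<otimes> h, (c + d) mod int n) w i = twist_act \<phi> n gc (twist_act \<phi> n hd w) i"
      using i assms by (simp add: twist_act_def composition_rule g h mod_simps diff_diff_eq)
  qed (simp_all add: twist_act_def)
  ultimately show "restrict (twist_act \<phi> n (gc \<otimes>\<^bsub>G \<times>\<times> integer_mod_group n\<^esub> hd)) (words n E) w =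
    restrict (twist_act \<phi> n gc) (words n E) (restrict (twist_act \<phi> n hd) (words n E) w)"
    using w by simp
qed simp

text \<open>
  A fixed word is determined by its first \<open>n/d\<close> letters, and comparing them after a full turn
  shows that \<open>h\<^sup>d\<close> has to fix them.
\<close>

lemma card_twist_act_fixed:
  assumes "n > 0" "d dvd n" "h \<in> carrier G"
  shows "card {w \<in> words n E. twist_act \<phi> n (h, int (n div d) mod int n) w = w} =
    card (invariants E \<phi> (h [^] d)) ^ (n div d)"
proof -
  interpret group G
    using group_hom group_hom.axioms(1) by auto
  obtain e where e: "n = d * e" using assms(2) by (auto elim: dvdE)
  then have de: "d > 0" "e > 0" "n div d = e" using assms(1) by auto
  define W where "W = {w \<in> words n E. twist_act \<phi> n (h, int e mod int n) w = w}"
  define X where "X = {0..<int e} \<rightarrow>\<^sub>E invariants E \<phi> (h [^] d)"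
  have hpow: "\<phi> h (\<phi> (h [^] k) x) = \<phi> (h [^] Suc k) x" if "x \<in> E" for k x
    using that assms(3) by (subst nat_pow_Suc2) (simp_all add: composition_rule)
  have pow_closed: "\<phi> (h [^] k) x \<in> E" if "x \<in> E" for k :: nat and x
    using that assms(3) by (simp add: act_closed)
  have ne: "int n = int d * int e" using e by simp
  have W_step: "w i = \<phi> h (w ((i - int e) mod int n))"
    if "w \<in> W" "i \<in> {0..<int n}" for w i
  proof -
    have "w i = twist_act \<phi> n (h, int e mod int n) w i"
      using that(1) by (simp add: W_def)
    then show ?thesis using that(2) by (simp add: twist_act_def mod_simps)
  qed
  have W_E: "w i \<in> E" if "w \<in> W" "i \<in> {0..<int n}" for w i
    using that by (auto simp: W_def)
  \<comment> \<open>Cut a word into \<open>d\<close> blocks of length \<open>e\<close>; then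
    \<open>r + k * e\<close> is the position of letter \<open>r\<close> in block
    \<open>k\<close>.\<close>
  have bound: "r + int k * int e \<in> {0..<int n}" if "r \<in> {0..<int e}" "k < d" for r k
  proof -
    have "r + int k * int e < (int k + 1) * int e" using that by (simp add: algebra_simps)
    also have "\<dots> \<le> int d * int e"
      using that by (intro mult_right_mono) auto
    finally show ?thesis using that ne by simp
  qed
  \<comment> \<open>Each move to the next block applies \<open>h\<close> once more.\<close>
  have W_pow: "w (r + int k * int e) = \<phi> (h [^] k) (w r)"
    if "w \<in> W" "r \<in> {0..<int e}" "k < d" for w r k
    using that(3)
  proof (induction k)
    case 0
    then show ?case
      using act_one[OF W_E[OF that(1) bound[OF that(2) 0]]] by simp
  next
    case (Suc k)
    have b: "r + int k * int e \<in> {0..<int n}" "r + int (Suc k) * int e \<in> {0..<int n}"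
      using bound[OF that(2), of k] bound[OF that(2) Suc.prems] Suc.prems by auto
    have "w (r + int (Suc k) * int e) = \<phi> h (w ((r + int (Suc k) * int e - int e) mod int n))"
      by (rule W_step[OF that(1) b(2)])
    also have "r + int (Suc k) * int e - int e = r + int k * int e"
      by (simp add: algebra_simps)
    also have "(r + int k * int e) mod int n = r + int k * int e"
      using b(1) by simp
    also have "w (r + int k * int e) = \<phi> (h [^] k) (w r)"
      using Suc by simp
    also have "\<phi> h \<dots> = \<phi> (h [^] Suc k) (w r)"
      using W_E[OF that(1) bound[OF that(2) de(1)]] by (intro hpow) simp
    finally show ?case .
  qed
  \<comment> \<open>A step back from block 0 leads cyclically into the last block, number
    \<open>d - 1\<close>.\<close>
  have wrap: "(r - int e) mod int n = r + int (d - 1) * int e" if "r \<in> {0..<int e}" for r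
  proof -
    have "r - int e + int n = r + int (d - 1) * int e"
      using de ne by (simp add: of_nat_diff algebra_simps)
    then show ?thesis
      using bound[OF that, of "d - 1"] de by (metis mod_add_self2 mod_pos_pos_trivial atLeastLessThan_iff diff_less zero_less_one)
  qed
  have W_inv: "w r \<in> invariants E \<phi> (h [^] d)" if "w \<in> W" "r \<in> {0..<int e}" for w r
  proof -
    have b: "r \<in> {0..<int n}" using bound[OF that(2) de(1)] by simp
    have "w r = \<phi> h (w (r + int (d - 1) * int e))"
      using W_step[OF that(1) b] wrap[OF that(2)] by simp
    also have "\<dots> = \<phi> h (\<phi> (h [^] (d - 1)) (w r))"
      using W_pow[OF that, of "d - 1"] de by simp
    also have "\<dots> = \<phi> (h [^] d) (w r)"
      using hpow[OF W_E[OF that(1) b], of "d - 1"] de by simp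
    finally show ?thesis using W_E[OF that(1) b] by (simp add: invariants_def)
  qed
  have split: "i = i mod int e + int (nat (i div int e)) * int e" "i mod int e \<in> {0..<int e}"
      "nat (i div int e) < d" if "i \<in> {0..<int n}" for i
  proof -
    have "i div int e \<ge> 0" using that de by (simp add: pos_imp_zdiv_nonneg_iff)
    then show "i = i mod int e + int (nat (i div int e)) * int e"
      by simp
    show "i mod int e \<in> {0..<int e}" using de by simp
    have "i div int e * int e \<le> i"
      using de by (simp add: minus_mod_eq_div_mult[symmetric])
    also have "i < int d * int e"
      using that ne by simp
    finally have "i div int e < int d"
      using de by (simp add: mult_less_cancel_right)
    then show "nat (i div int e) < d"
      using de by (simp add: nat_less_iff)
  qed
  have "bij_betw (\<lambda>w. restrict w {0..<int e}) W X"
  proof (rule bij_betw_imageI)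
    show "inj_on (\<lambda>w. restrict w {0..<int e}) W"
    proof (rule inj_onI)
      fix v w assume vw: "v \<in> W" "w \<in> W" "restrict v {0..<int e} = restrict w {0..<int e}"
      have eq: "v r = w r" if "r \<in> {0..<int e}" for r
        using fun_cong[OF vw(3), of r] that by simp
      have eqn: "v i = w i" if "i \<in> {0..<int n}" for i
        using W_pow[OF vw(1) split(2,3)[OF that]] W_pow[OF vw(2) split(2,3)[OF that]]
          eq[OF split(2)[OF that]] split(1)[OF that] by metis
      show "v = w"
        using vw eqn by (intro PiE_ext[of v "{0..<int n}" "\<lambda>_. E" w]) (auto simp: W_def)
    qed
    show "(\<lambda>w. restrict w {0..<int e}) ` W = X"
    proof (intro equalityI subsetI)
      fix x assume "x \<in> (\<lambda>w. restrict w {0..<int e}) ` W"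
      then show "x \<in> X" using W_inv by (auto simp: X_def)
    next
      fix x assume x: "x \<in> X"
      have xE: "x r \<in> E" "\<phi> (h [^] d) (x r) = x r" if "r \<in> {0..<int e}" for r
        using PiE_mem[OF x[unfolded X_def] that] by (simp_all add: invariants_def)
      \<comment> \<open>The inverse of restriction to the first block: block \<open>k\<close> is
        \<open>x\<close> acted on by \<open>h [^] k\<close>.\<close>
      define w where "w = (\<lambda>i\<in>{0..<int n}. \<phi> (h [^] nat (i div int e)) (x (i mod int e)))"
      have w_eq: "w (r + int k * int e) = \<phi> (h [^] k) (x r)" if "r \<in> {0..<int e}" "k < d" for r k
        using bound[OF that] that de by (simp add: w_def div_pos_pos_trivial)
      have w_E: "w \<in> words n E"
        unfolding w_def by (intro restrict_PiE_iff[THEN iffD2] ballI pow_closed xE split(2))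
      have fixed: "w i = \<phi> h (w ((i - int e) mod int n))" if i: "i \<in> {0..<int n}" for i
      proof -
        define r k where "r = i mod int e" and "k = nat (i div int e)"
        have rk: "i = r + int k * int e" "r \<in> {0..<int e}" "k < d"
          using split[OF i] unfolding r_def k_def by blast+
        show ?thesis
        proof (cases k)
          \<comment> \<open>The preceding block is the last one, and the invariance of
            \<open>x\<close> under \<open>h [^] d\<close> closes the cycle.\<close>
          case 0
          have "\<phi> h (w ((i - int e) mod int n)) = \<phi> h (w (r + int (d - 1) * int e))"
            using rk 0 wrap[OF rk(2)] by simp
          also have "\<dots> = \<phi> h (\<phi> (h [^] (d - 1)) (x r))"
            using w_eq[OF rk(2), of "d - 1"] de by simp
          also have "\<dots> = \<phi> (h [^] d) (x r)"
            using hpow[OF xE(1)[OF rk(2)], of "d - 1"] de by simp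
          also have "\<dots> = \<phi> (h [^] k) (x r)"
            using xE[OF rk(2)] 0 act_one by simp
          finally show ?thesis using w_eq[OF rk(2,3)] rk(1) by simp
        next
          case (Suc l)
          have "(i - int e) mod int n = (r + int l * int e) mod int n"
            using rk(1) Suc by (simp add: algebra_simps)
          also have "\<dots> = r + int l * int e"
            using bound[OF rk(2), of l] rk(3) Suc by simp
          finally have "\<phi> h (w ((i - int e) mod int n)) = \<phi> h (\<phi> (h [^] l) (x r))"
            using w_eq[OF rk(2), of l] rk(3) Suc by simp
          also have "\<dots> = \<phi> (h [^] k) (x r)"
            using hpow[OF xE(1)[OF rk(2)]] Suc by simp
          finally show ?thesis using w_eq[OF rk(2,3)] rk(1) by simp
        qed
      qed
      have "twist_act \<phi> n (h, int e mod int n) w = w"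
      proof (rule extensionalityI[of _ "{0..<int n}"])
        fix i assume i: "i \<in> {0..<int n}"
        then have "twist_act \<phi> n (h, int e mod int n) w i = \<phi> h (w ((i - int e) mod int n))"
          by (simp add: twist_act_def mod_simps)
        then show "twist_act \<phi> n (h, int e mod int n) w i = w i"
          by (simp only: fixed[OF i, symmetric])
      qed (simp_all add: twist_act_def w_def)
      then have "w \<in> W" using w_E by (simp add: W_def)
      moreover have "restrict w {0..<int e} = x"
      proof (rule extensionalityI[of _ "{0..<int e}"])
        fix r assume "r \<in> {0..<int e}"
        then show "restrict w {0..<int e} r = x r"
          using w_eq[of r 0] de xE act_one by simp
      qed (use x in \<open>auto simp: X_def PiE_def\<close>)
      ultimately show "x \<in> (\<lambda>w. restrict w {0..<int e}) ` W" by blast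
    qed
  qed
  then have "card W = card X" by (rule bij_betw_same_card)
  also have "card X = card (invariants E \<phi> (h [^] d)) ^ e"
    by (simp add: X_def card_PiE)
  finally show ?thesis using de by (simp add: W_def)
qed

text \<open>Stronger than primitivity in combinatorics on words, which concerns pure rotations
  (\<open>g = \<one>\<close>): here a nontrivial rotation must not be undone by any letterwise
  action of \<open>G\<close> either.\<close>

definition primitive_words :: "nat \<Rightarrow> (int \<Rightarrow> 'c) set"
  where "primitive_words n = {w \<in> words n E. \<forall>(g, c)\<in>stabilizer (G \<times>\<times> integer_mod_group n)
    (\<lambda>gc. restrict (twist_act \<phi> n gc) (words n E)) w. c = 0}"


text \<open>Double counting of pairs of a group element and a fixed word, as in Burnside's lemma,
  followed by the Moebius sum over each stabilizer, a subgroup of the direct product.\<close>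

lemma sum_moebius_mu_invariants:
  assumes "n > 0" "finite (carrier G)" "finite E"
  shows "(\<Sum>d | d dvd n. moebius_mu d *
      (\<Sum>g\<in>carrier G. int (card (invariants E \<phi> (g [^] d)) ^ (n div d)))) =
    int (\<Sum>w\<in>primitive_words n. card (stabilizer (G \<times>\<times> integer_mod_group n)
      (\<lambda>gc. restrict (twist_act \<phi> n gc) (words n E)) w))"
proof -
  let ?P = "G \<times>\<times> integer_mod_group n"
  let ?\<psi> = "\<lambda>gc. restrict (twist_act \<phi> n gc) (words n E)"
  interpret P: group_action ?P "words n E" ?\<psi>
    by (rule twist_act_action[OF assms(1)])
  have "group G"
    using group_hom group_hom.axioms(1) by auto
  have fin: "finite (words n E)"
    using assms by (intro finite_PiE) auto
  have cmem: "c mod int n \<in> carrier (integer_mod_group n)" for c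
    using assms(1) by (simp add: carrier_integer_mod_group)
  have "(\<Sum>g\<in>carrier G. card (invariants E \<phi> (g [^] d)) ^ (n div d)) =
      (\<Sum>w\<in>words n E. card {g. (g, int (n div d) mod int n) \<in> stabilizer ?P ?\<psi> w})"
    if "d dvd n" for d
  proof -
    let ?R = "\<lambda>g w. twist_act \<phi> n (g, int (n div d) mod int n) w = w"
    have "(\<Sum>g\<in>carrier G. card (invariants E \<phi> (g [^] d)) ^ (n div d)) =
        (\<Sum>g\<in>carrier G. card {w \<in> words n E. ?R g w})"
      by (intro sum.cong refl card_twist_act_fixed[symmetric] assms that)
    also have "\<dots> = (\<Sum>w\<in>words n E. card {g \<in> carrier G. ?R g w})"
      using assms(2) fin by (intro sum_multicount_gen) auto
    also have "\<dots> = (\<Sum>w\<in>words n E. card {g. (g, int (n div d) mod int n) \<in> stabilizer ?P ?\<psi> w})"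
      by (intro sum.cong refl arg_cong[where f = card]) (auto simp: stabilizer_def cmem)
    finally show ?thesis .
  qed
  then have "(\<Sum>d | d dvd n. moebius_mu d *
      (\<Sum>g\<in>carrier G. int (card (invariants E \<phi> (g [^] d)) ^ (n div d)))) =
    (\<Sum>d | d dvd n. \<Sum>w\<in>words n E. moebius_mu d *
      int (card {g. (g, int (n div d) mod int n) \<in> stabilizer ?P ?\<psi> w}))"
    by (intro sum.cong refl) (simp only: of_nat_sum[symmetric] mem_Collect_eq, simp add: sum_distrib_left)
  also have "\<dots> = (\<Sum>w\<in>words n E. \<Sum>d | d dvd n. moebius_mu d *
      int (card {g. (g, int (n div d) mod int n) \<in> stabilizer ?P ?\<psi> w}))"
    by (rule sum.swap)
  also have "\<dots> = (\<Sum>w\<in>words n E. if \<forall>(g, c)\<in>stabilizer ?P ?\<psi> w. c = 0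
      then int (card (stabilizer ?P ?\<psi> w)) else 0)"
    by (intro sum.cong refl P.stabilizer_subgroup
        sum_moebius_mu_subgroup_DirProd[OF \<open>group G\<close> assms(1)])
  also have "\<dots> = (\<Sum>w\<in>primitive_words n. int (card (stabilizer ?P ?\<psi> w)))"
    unfolding primitive_words_def by (rule sum.inter_filter[symmetric, OF fin])
  finally show ?thesis by simp
qed

text \<open>Primitive words are closed under the action: stabilizers along an orbit are conjugate,
  and conjugation does not change the component in the abelian cyclic factor.\<close>

lemma order_dvd_sum_primitive_words:
  assumes "n > 0" "finite (carrier G)" "finite E"
  shows "order G * n dvd (\<Sum>w\<in>primitive_words n. card (stabilizer (G \<times>\<times> integer_mod_group n)
      (\<lambda>gc. restrict (twist_act \<phi> n gc) (words n E)) w))"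
proof -
  let ?P = "G \<times>\<times> integer_mod_group n"
  let ?\<psi> = "\<lambda>gc. restrict (twist_act \<phi> n gc) (words n E)"
  interpret P: group_action ?P "words n E" ?\<psi>
    by (rule twist_act_action[OF assms(1)])
  interpret G: group G
    using group_hom group_hom.axioms(1) by auto
  interpret PG: group ?P
    by (simp add: DirProd_group)
  have fin: "finite (words n E)"
    using assms by (intro finite_PiE) auto
  have "order ?P dvd (\<Sum>w\<in>primitive_words n. card (stabilizer ?P ?\<psi> w))"
  proof (rule P.order_dvd_sum_card_stabilizer)
    show "finite (carrier ?P)"
      using assms by (simp add: carrier_integer_mod_group)
    show "primitive_words n \<subseteq> words n E"
      by (auto simp: primitive_words_def)
    fix a w assume a: "a \<in> carrier ?P" and "w \<in> primitive_words n"
    then have w: "w \<in> words n E"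
      by (simp add: primitive_words_def)
    have prim: "c = 0" if "(g, c) \<in> stabilizer ?P ?\<psi> w" for g c
      using that \<open>w \<in> primitive_words n\<close> by (auto simp: primitive_words_def)
    have "c = 0" if "(g, c) \<in> stabilizer ?P ?\<psi> (?\<psi> a w)" for g c
    proof -
      have gc: "(g, c) \<in> carrier ?P" "?\<psi> (g, c) (?\<psi> a w) = ?\<psi> a w"
        using that unfolding stabilizer_def by blast+
      \<comment> \<open>Conjugation by \<open>a\<close> carries the stabilizer of the moved word
        back to that of \<open>w\<close>.\<close>
      let ?b = "inv\<^bsub>?P\<^esub> a \<otimes>\<^bsub>?P\<^esub> ((g, c) \<otimes>\<^bsub>?P\<^esub> a)"
      have "?\<psi> ?b w = ?\<psi> (inv\<^bsub>?P\<^esub> a) (?\<psi> (g, c) (?\<psi> a w))"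
        by (simp only: P.composition_rule w a gc(1) PG.inv_closed PG.m_closed P.act_closed)
      also have "\<dots> = w"
        unfolding gc(2) by (rule P.orbit_sym_aux[OF a w refl])
      finally have b: "?b \<in> stabilizer ?P ?\<psi> w"
        unfolding stabilizer_def using a gc(1) PG.inv_closed PG.m_closed by blast
      obtain h d where "a = (h, d)" by (cases a)
      then have "snd ?b = c mod int n"
        using a by (simp add: mod_simps)
      also have "\<dots> = c"
        using gc(1) assms(1) by (simp add: carrier_integer_mod_group)
      finally have "snd ?b = c" .
      moreover have "snd ?b = 0"
        by (rule prim[of "fst ?b"]) (simp only: prod.collapse b)
      ultimately show "c = 0" by (rule trans[OF sym])
    qed
    then show "?\<psi> a w \<in> primitive_words n"
      unfolding primitive_words_def using P.act_closed[OF a w] by blast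
  qed (use fin in auto)
  then show ?thesis
    using assms(1) by (simp add: order_def card_cartesian_product carrier_integer_mod_group)
qed

lemma card_stabilizer_pos:
  assumes "finite (carrier G)" "x \<in> E"
  shows "card (stabilizer G \<phi> x) > 0"
  using stabilizer_one_closed[OF assms(2)] finite_subset[OF stabilizer_subset assms(1)]
  by (auto simp: card_gt_0_iff)

text \<open>The letter \<open>x\<close> is fixed by \<open>G\<close> and stands at position 0 only;
  rotation by \<open>c\<close> moves it to position \<open>c\<close>, which forces
  \<open>c = 0\<close>. For \<open>n = 1\<close> there is no other position, so \<open>y\<close> may
  equal \<open>x\<close>.\<close>

lemma primitive_words_fixed_letter:
  assumes "x \<in> E" "\<And>g. g \<in> carrier G \<Longrightarrow> \<phi> g x = x" "y \<in> E" "n = 1 \<or> y \<noteq> x" "n > 0"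
  shows "(\<lambda>i\<in>{0..<int n}. if i = 0 then x else y) \<in> primitive_words n"
proof -
  let ?w = "\<lambda>i\<in>{0..<int n}. if i = 0 then x else y"
  interpret G: group G
    using group_hom group_hom.axioms(1) by auto
  have w: "?w \<in> words n E" using assms by auto
  have "c = 0" if "g \<in> carrier G" "c \<in> {0..<int n}" "twist_act \<phi> n (g, c) ?w = ?w" for g c
  proof -
    have "twist_act \<phi> n (g, c) ?w c = x"
      using that(1,2) assms by (simp add: twist_act_def)
    then have "?w c = x" by (simp only: that(3))
    then show "c = 0" using that(2) assms(4) by (auto split: if_splits)
  qed
  then show ?thesis
    using w assms(5) by (auto simp: primitive_words_def stabilizer_def carrier_integer_mod_group)
qed

text \<open>The only word is fixed by every element, in particular by rotation by 1, a nonzero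
  residue since \<open>n > 1\<close>.\<close>

lemma primitive_words_singleton:
  assumes "E = {x}" "n > 1"
  shows "primitive_words n = {}"
proof -
  interpret G: group G
    using group_hom group_hom.axioms(1) by auto
  have "(\<one>, 1) \<in> stabilizer (G \<times>\<times> integer_mod_group n)
    (\<lambda>gc. restrict (twist_act \<phi> n gc) (words n E)) w" if "w \<in> words n E" for w
  proof -
    have "v = w" if "v \<in> words n E" for v
      using that \<open>w \<in> words n E\<close> assms(1) by (auto intro!: PiE_ext dest!: PiE_mem)
    then have "twist_act \<phi> n (\<one>, 1) w = w"
      using twist_act_closed[OF _ G.one_closed that, of 1] assms(2) by blast
    then show ?thesis
      using that assms(2) by (simp add: stabilizer_def)
  qed
  then show ?thesis
    by (auto simp: primitive_words_def intro!: bexI[of _ "(\<one>, 1 :: int)"])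
qed

end

section \<open>Hall subgroups\<close>

lemma coprimeI_no_common_prime:
  fixes a b :: nat
  assumes "\<And>p. prime p \<Longrightarrow> p dvd a \<Longrightarrow> p dvd b \<Longrightarrow> False"
  shows "coprime a b"
proof (rule ccontr)
  assume "\<not> coprime a b"
  then obtain p where "prime p" "p dvd gcd a b"
    using prime_factor_nat coprime_iff_gcd_eq_1 by blast
  then show False using assms by auto
qed

context group
begin

text \<open>The order of the image of \<open>x\<close> in \<open>N(K)/K\<close> divides both \<open>n\<close> and the index of \<open>K\<close>.\<close>

lemma mem_subgroup_if_normalizes:
  assumes fin: "finite (carrier G)" and K: "subgroup K G" and x: "x \<in> carrier G"
    and pow: "x [^] n = \<one>" and cop: "coprime n (card (rcosets K))"
    and conj: "x <# K #> inv x = K"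
  shows "x \<in> K"
proof -
  let ?N = "G\<lparr>carrier := normalizer G K\<rparr>"
  have K_sub: "K \<subseteq> carrier G"
    using K by (rule subgroup.subset)
  have N: "subgroup (normalizer G K) G"
    by (rule normalizer_imp_subgroup[OF K_sub])
  interpret N: group ?N
    by (rule subgroup_imp_group[OF N])
  interpret K: normal K ?N
    by (rule subgroup_in_normalizer[OF K])
  interpret Q: group "?N Mod K"
    by (rule K.factorgroup_is_group)
  have xN: "x \<in> carrier ?N"
    using x conj K_sub by (simp add: normalizer_def stabilizer_def)
  have X: "K #>\<^bsub>?N\<^esub> x \<in> carrier (?N Mod K)"
    using xN by (simp add: carrier_FactGroup)
  have "(K #>\<^bsub>?N\<^esub> x) [^]\<^bsub>?N Mod K\<^esub> n = K #>\<^bsub>?N\<^esub> (x [^]\<^bsub>?N\<^esub> n)"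
    by (rule K.FactGroup_pow[OF xN])
  also have "x [^]\<^bsub>?N\<^esub> n = \<one>\<^bsub>?N\<^esub>"
    using pow by (simp add: nat_pow_consistent[symmetric])
  also have "K #>\<^bsub>?N\<^esub> \<one>\<^bsub>?N\<^esub> = \<one>\<^bsub>?N Mod K\<^esub>"
    using N.coset_mult_one[OF K.subset] by simp
  finally have "Q.ord (K #>\<^bsub>?N\<^esub> x) dvd n"
    using Q.pow_eq_id[OF X] by blast
  moreover have "Q.ord (K #>\<^bsub>?N\<^esub> x) dvd card (rcosets K)"
  proof -
    have "card K > 0"
      using K_sub fin finite_subset subgroup.one_closed[OF K] by (auto simp: card_gt_0_iff)
    have "order (?N Mod K) * card K = card (normalizer G K)"
      using N.lagrange[OF K.is_subgroup] by (simp add: order_def FactGroup_def)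
    \<comment> \<open>By Lagrange, the index of \<open>K\<close> is the index of its normalizer
      times the order of the quotient.\<close>
    then have "(card (rcosets (normalizer G K)) * order (?N Mod K)) * card K = card (rcosets K) * card K"
      using lagrange[OF N] lagrange[OF K] by (simp add: mult.assoc)
    then have "order (?N Mod K) dvd card (rcosets K)"
      using \<open>card K > 0\<close> by (metis dvd_triv_right mult_cancel2 neq0_conv)
    then show ?thesis
      using Q.ord_dvd_group_order[OF X] dvd_trans by blast
  qed
  ultimately have "Q.ord (K #>\<^bsub>?N\<^esub> x) = 1"
    using cop coprime_common_divisor_nat by blast
  then have "K #>\<^bsub>?N\<^esub> x = K"
    using Q.ord_eq_1[OF X] by simp
  then show ?thesis
    using N.coset_join1[OF _ xN K.is_subgroup] by simp
qed

section \<open>Conjugation on the subgroups of a fixed order\<close>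

lemma l_coset_r_coset_image:
  assumes "g \<in> carrier G"
  shows "g <# K #> inv g = (\<lambda>k. g \<otimes> k \<otimes> inv g) ` K"
  by (auto simp: l_coset_def r_coset_def)

lemma card_conjugate:
  assumes "g \<in> carrier G" "K \<subseteq> carrier G"
  shows "card (g <# K #> inv g) = card K"
proof -
  have "inj_on (\<lambda>k. g \<otimes> k \<otimes> inv g) K"
    using assms by (intro inj_onI) (meson conjugation_is_inj subsetD)
  then show ?thesis
    by (simp add: l_coset_r_coset_image[OF assms(1)] card_image)
qed

lemma conjugate_self:
  assumes "subgroup K G" "x \<in> K"
  shows "x <# K #> inv x = K"
  using assms by (metis coset_join2 coset_join3 subgroup.mem_carrier subgroup.m_inv_closed)

lemma conjugation_action_on_card:
  assumes "subgroup H G"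
  shows "group_action (G\<lparr>carrier := H\<rparr>) {K. subgroup K G \<and> card K = n}
    (\<lambda>g. \<lambda>K\<in>{K. subgroup K G \<and> card K = n}. g <# K #> inv g)"
proof (rule group_actionI)
  \<comment> \<open>The identity and composition laws are inherited from conjugation on all
    subgroups.\<close>
  interpret A: group_action G "{H. subgroup H G}" "\<lambda>g. \<lambda>H \<in> {H. subgroup H G}. g <# H #> (inv g)"
    by (rule action_by_conjugation_on_subgroups_set)
  let ?E = "{K. subgroup K G \<and> card K = n}"
  show "group (G\<lparr>carrier := H\<rparr>)"
    by (rule subgroup_imp_group[OF assms])
  have closed: "g <# K #> inv g \<in> ?E" if "g \<in> H" "K \<in> ?E" for g K
    using that assms
    by (auto simp: card_conjugate subgroup.mem_carrier subgroup.subset subgroup_conjugation_is_surj2)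
  then show "(\<lambda>K\<in>?E. g <# K #> inv g) K \<in> ?E"
    if "g \<in> carrier (G\<lparr>carrier := H\<rparr>)" "K \<in> ?E" for g K
    using that by simp
  show "(\<lambda>K\<in>?E. \<one>\<^bsub>G\<lparr>carrier := H\<rparr>\<^esub> <# K #> inv \<one>\<^bsub>G\<lparr>carrier := H\<rparr>\<^esub>) K = K" if "K \<in> ?E" for K
    using that A.act_one[of K] by simp
  show "(\<lambda>K\<in>?E. g \<otimes>\<^bsub>G\<lparr>carrier := H\<rparr>\<^esub> h <# K #> inv (g \<otimes>\<^bsub>G\<lparr>carrier := H\<rparr>\<^esub> h)) K =
      (\<lambda>K\<in>?E. g <# K #> inv g) ((\<lambda>K\<in>?E. h <# K #> inv h) K)"
    if "g \<in> carrier (G\<lparr>carrier := H\<rparr>)" "h \<in> carrier (G\<lparr>carrier := H\<rparr>)" "K \<in> ?E" for g h K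
  proof -
    have "g \<in> carrier G" "h \<in> carrier G"
      using that assms by (auto simp: subgroup.mem_carrier)
    then show ?thesis
      using that closed[of h K] A.composition_rule[of K g h] by simp
  qed
qed simp

text \<open>Order times index is the same for \<open>H\<close> and \<open>K\<close>. If each order
  is coprime to the other index, the two orders divide each other; conversely, equal orders force
  equal indices.\<close>

lemma hall_pi_subgroup_iff:
  assumes fin: "finite (carrier G)" and H: "hall_subgroup G H" and \<pi>: "\<pi> = {p. prime p \<and> p dvd card H}"
  shows "hall_pi_subgroup G \<pi> K \<longleftrightarrow> subgroup K G \<and> card K = card H"
proof -
  have sub: "subgroup H G" and cop: "coprime (card H) (card (rcosets H))"
    using H by (auto simp: hall_subgroup_def)
  have pos: "card L > 0" if "subgroup L G" for L
    using that fin by (metis card_gt_0_iff empty_iff finite_subset subgroup.one_closed subgroup.subset)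
  show ?thesis
  proof
    assume K: "hall_pi_subgroup G \<pi> K"
    then have subK: "subgroup K G" by (simp add: hall_pi_subgroup_def)
    have eq: "card (rcosets K) * card K = card (rcosets H) * card H"
      using lagrange[OF sub] lagrange[OF subK] by simp
    have "coprime (card H) (card (rcosets K))"
      by (rule coprimeI_no_common_prime) (use K in \<open>auto simp: hall_pi_subgroup_def \<pi>\<close>)
    then have "card H dvd card K"
      using eq by (metis coprime_dvd_mult_right_iff dvd_triv_right)
    moreover have "coprime (card K) (card (rcosets H))"
    proof (rule coprimeI_no_common_prime)
      fix p assume p: "prime p" "p dvd card K" "p dvd card (rcosets H)"
      then have "p dvd card H" using K by (auto simp: hall_pi_subgroup_def \<pi>)
      then show False using cop p by (meson coprime_common_divisor not_prime_unit)
    qed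
    then have "card K dvd card H"
      using eq by (metis coprime_dvd_mult_right_iff dvd_triv_right)
    ultimately show "subgroup K G \<and> card K = card H"
      using subK dvd_antisym by blast
  next
    assume K: "subgroup K G \<and> card K = card H"
    then have "card (rcosets K) = card (rcosets H)"
      using lagrange[OF sub] lagrange[of K] pos[OF sub] by (metis mult_cancel2 neq0_conv)
    then show "hall_pi_subgroup G \<pi> K"
      using K cop by (auto simp: hall_pi_subgroup_def \<pi> dest: coprime_common_divisor_nat)
  qed
qed

end

section \<open>Orbit counting for conjugation on Hall subgroups\<close>

theorem theorem3:
  fixes G :: "('a, 'b) monoid_scheme" and H :: "'a set" and n :: nat and \<pi> :: "nat set"
  assumes "group G"
    and "finite (carrier G)"
    and "hall_subgroup G H"
    and "n = card H"
    and "\<pi> = {p. prime p \<and> p dvd n}"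
  shows "let S = 1 / rat_of_nat n ^ 2 *
              (\<Sum>d | d dvd n. rat_of_int (moebius_mu d) *
                (\<Sum>h\<in>H. rat_of_nat (hall_count G \<pi> (h [^]\<^bsub>G\<^esub> d)) ^ (n div d)))
         in S \<in> \<nat> \<and> (S = 0 \<longleftrightarrow> H \<noteq> {\<one>\<^bsub>G\<^esub>} \<and> H \<lhd> G)"
proof -
  interpret G: group G by fact
  let ?H = "G\<lparr>carrier := H\<rparr>"
  define \<Omega> where "\<Omega> = {K. subgroup K G \<and> card K = n}"
  define \<phi> where "\<phi> = (\<lambda>g. \<lambda>K\<in>\<Omega>. g <#\<^bsub>G\<^esub> K #>\<^bsub>G\<^esub> inv\<^bsub>G\<^esub> g)"
  have H: "subgroup H G" and cop: "coprime n (card (rcosets\<^bsub>G\<^esub> H))"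
    using assms by (auto simp: hall_subgroup_def)
  interpret A: group_action ?H \<Omega> \<phi>
    unfolding \<Omega>_def \<phi>_def by (rule G.conjugation_action_on_card[OF H])
  have hall_iff: "hall_pi_subgroup G \<pi> K \<longleftrightarrow> K \<in> \<Omega>" for K
    using G.hall_pi_subgroup_iff[OF assms(2,3)] assms(4,5) by (simp add: \<Omega>_def)
  have finH: "finite (carrier ?H)"
    using subgroup.subset[OF H] assms(2) by (auto intro: finite_subset)
  have n: "n > 0"
    using finH subgroup.one_closed[OF H] assms(4) by (auto simp: card_gt_0_iff)
  have finO: "finite \<Omega>"
    by (rule finite_subset[of _ "Pow (carrier G)"])
      (use assms(2) subgroup.subset in \<open>auto simp: \<Omega>_def\<close>)
  have HO: "H \<in> \<Omega>" using H assms(4) by (simp add: \<Omega>_def)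
  have pow: "x [^]\<^bsub>G\<^esub> n = \<one>\<^bsub>G\<^esub>" if "K \<in> \<Omega>" "x \<in> K" for x K
  proof -
    interpret K: group "G\<lparr>carrier := K\<rparr>"
      using that by (intro G.subgroup_imp_group) (simp add: \<Omega>_def)
    have "x [^]\<^bsub>G\<lparr>carrier := K\<rparr>\<^esub> order (G\<lparr>carrier := K\<rparr>) = \<one>\<^bsub>G\<lparr>carrier := K\<rparr>\<^esub>"
      by (rule K.pow_order_eq_1) (use that in simp)
    then show ?thesis
      using that by (simp add: \<Omega>_def order_def G.nat_pow_consistent[symmetric])
  qed
  \<comment> \<open>Membership in \<open>L\<close> gives \<open>x [^] n = \<one>\<close>, and all
    members of \<open>\<Omega>\<close> have the index of \<open>H\<close>, which is coprime to
    \<open>n\<close>.\<close>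
  have mem: "x \<in> K" if "K \<in> \<Omega>" "L \<in> \<Omega>" "x \<in> L" "x <#\<^bsub>G\<^esub> K #>\<^bsub>G\<^esub> inv\<^bsub>G\<^esub> x = K" for x K L
  proof (rule G.mem_subgroup_if_normalizes[OF assms(2) _ _ pow[OF that(2,3)] _ that(4)])
    show "subgroup K G" using that(1) by (simp add: \<Omega>_def)
    then have "card (rcosets\<^bsub>G\<^esub> K) * n = card (rcosets\<^bsub>G\<^esub> H) * n"
      using G.lagrange[of K] G.lagrange[OF H] that(1) assms(4) by (simp add: \<Omega>_def)
    then show "coprime n (card (rcosets\<^bsub>G\<^esub> K))"
      using cop n by simp
    show "x \<in> carrier G"
      using that(2,3) by (auto simp: \<Omega>_def subgroup.mem_carrier)
  qed
  \<comment> \<open>The fixed points of \<open>h\<close> are the Hall subgroups it normalizes; by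
    \<open>mem\<close> they contain it.\<close>
  have count: "hall_count G \<pi> h = card (invariants \<Omega> \<phi> h)" if "h \<in> H" for h
  proof -
    have "{K. hall_pi_subgroup G \<pi> K \<and> h \<in> K} = invariants \<Omega> \<phi> h"
      using mem[OF _ HO that] G.conjugate_self
      by (auto simp: hall_iff invariants_def \<phi>_def) (auto simp: \<Omega>_def)
    then show ?thesis by (simp add: hall_count_def)
  qed
  have powH: "h [^]\<^bsub>G\<^esub> d \<in> H" if "h \<in> H" for h and d :: nat
    using monoid.nat_pow_closed[OF group.is_monoid[OF G.subgroup_imp_group[OF H]], of h d] that
    by (simp flip: G.nat_pow_consistent)
  define T where "T = (\<Sum>w\<in>A.primitive_words n. card (stabilizer (?H \<times>\<times> integer_mod_group n)
      (\<lambda>gc. restrict (twist_act \<phi> n gc) (words n \<Omega>)) w))"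
  have "(\<Sum>d | d dvd n. rat_of_int (moebius_mu d) *
      (\<Sum>h\<in>H. rat_of_nat (hall_count G \<pi> (h [^]\<^bsub>G\<^esub> d)) ^ (n div d))) =
    rat_of_int (\<Sum>d | d dvd n. moebius_mu d *
      (\<Sum>g\<in>carrier ?H. int (card (invariants \<Omega> \<phi> (g [^]\<^bsub>?H\<^esub> d)) ^ (n div d))))"
    by (simp add: count powH flip: G.nat_pow_consistent)
  also have "\<dots> = rat_of_nat T"
    unfolding A.sum_moebius_mu_invariants[OF n finH finO] T_def by simp
  finally have sum_eq: "(\<Sum>d | d dvd n. rat_of_int (moebius_mu d) *
      (\<Sum>h\<in>H. rat_of_nat (hall_count G \<pi> (h [^]\<^bsub>G\<^esub> d)) ^ (n div d))) = rat_of_nat T" .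
  have "n * n dvd T"
    using A.order_dvd_sum_primitive_words[OF n finH finO] assms(4) by (simp add: T_def order_def)
  then obtain q where q: "T = n * n * q" by (rule dvdE)
  \<comment> \<open>Every stabilizer contains the identity, so each primitive word contributes a
    positive term.\<close>
  have T0: "T = 0 \<longleftrightarrow> A.primitive_words n = {}"
  proof -
    interpret P: group_action "?H \<times>\<times> integer_mod_group n" "words n \<Omega>"
        "\<lambda>gc. restrict (twist_act \<phi> n gc) (words n \<Omega>)"
      by (rule A.twist_act_action[OF n])
    have "finite (words n \<Omega>)"
      using finO by (intro finite_PiE) auto
    then have "finite (A.primitive_words n)"
      by (rule rev_finite_subset) (auto simp: A.primitive_words_def)
    moreover have "card (stabilizer (?H \<times>\<times> integer_mod_group n)
        (\<lambda>gc. restrict (twist_act \<phi> n gc) (words n \<Omega>)) w) > 0" if "w \<in> A.primitive_words n" for w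
      using that finH n
      by (intro P.card_stabilizer_pos) (auto simp: A.primitive_words_def carrier_integer_mod_group)
    ultimately show ?thesis
      unfolding T_def by (auto simp: sum_eq_0_iff)
  qed
  also have "A.primitive_words n = {} \<longleftrightarrow> H \<noteq> {\<one>\<^bsub>G\<^esub>} \<and> H \<lhd> G"
  proof
    assume R: "H \<noteq> {\<one>\<^bsub>G\<^esub>} \<and> H \<lhd> G"
    have "K = H" if K: "K \<in> \<Omega>" for K
    proof -
      \<comment> \<open>Every \<open>k\<close> normalizes the normal subgroup \<open>H\<close>,
        hence lies in it; equal orders then give \<open>K = H\<close>.\<close>
      have "k \<in> H" if "k \<in> K" for k
      proof (rule mem[OF HO K that])
        have "k \<in> carrier G" using K that by (auto simp: \<Omega>_def subgroup.mem_carrier)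
        then show "k <#\<^bsub>G\<^esub> H #>\<^bsub>G\<^esub> inv\<^bsub>G\<^esub> k = H"
          using R normal.coset_eq[of H G] subgroup.subset[OF H]
          by (metis G.coset_mult_assoc G.coset_mult_one G.inv_closed G.r_inv)
      qed
      then show ?thesis
        using card_subset_eq[of H K] finH K assms(4) by (auto simp: \<Omega>_def)
    qed
    then have "\<Omega> = {H}" using HO by blast
    moreover have "n > 1"
      using R n assms(4) subgroup.one_closed[OF H] by (metis card_1_singletonE less_one nat_neq_iff singletonD)
    ultimately show "A.primitive_words n = {}"
      by (rule A.primitive_words_singleton)
  next
    assume empty: "A.primitive_words n = {}"
    show "H \<noteq> {\<one>\<^bsub>G\<^esub>} \<and> H \<lhd> G"
    proof (rule ccontr)
      assume neg: "\<not> (H \<noteq> {\<one>\<^bsub>G\<^esub>} \<and> H \<lhd> G)"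
      \<comment> \<open>If \<open>H\<close> is trivial, then \<open>n = 1\<close> and
        \<open>H\<close> itself serves; otherwise \<open>H\<close> is not normal and some conjugate
        differs from it.\<close>
      have "\<exists>K\<in>\<Omega>. n = 1 \<or> K \<noteq> H"
      proof (cases "H = {\<one>\<^bsub>G\<^esub>}")
        case True
        then show ?thesis using HO assms(4) by auto
      next
        case False
        then obtain x h where xh: "x \<in> carrier G" "h \<in> H" "x \<otimes>\<^bsub>G\<^esub> h \<otimes>\<^bsub>G\<^esub> inv\<^bsub>G\<^esub> x \<notin> H"
          using neg H G.normal_inv_iff by blast
        let ?K = "x <#\<^bsub>G\<^esub> H #>\<^bsub>G\<^esub> inv\<^bsub>G\<^esub> x"
        have "?K \<in> \<Omega>"
          using xh H assms(4)
          by (simp add: \<Omega>_def G.subgroup_conjugation_is_surj2 G.card_conjugate subgroup.subset)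
        moreover have "?K \<noteq> H"
          using xh by (auto simp: G.l_coset_r_coset_image)
        ultimately show ?thesis by blast
      qed
      then obtain K where "K \<in> \<Omega>" "n = 1 \<or> K \<noteq> H" by blast
      \<comment> \<open>\<open>H\<close> is fixed under conjugation by its own elements, so it can
        be the letter at position 0.\<close>
      moreover have "\<phi> g H = H" if "g \<in> carrier ?H" for g
        using that HO G.conjugate_self[OF H] by (simp add: \<phi>_def)
      ultimately show False
        using A.primitive_words_fixed_letter[OF HO _ _ _ n, of K] empty by blast
    qed
  qed
  finally have "q = 0 \<longleftrightarrow> H \<noteq> {\<one>\<^bsub>G\<^esub>} \<and> H \<lhd> G"
    using q n by simp
  moreover have "1 / rat_of_nat n ^ 2 * rat_of_nat T = rat_of_nat q"
    using n by (simp add: q power2_eq_square)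
  ultimately show ?thesis
    unfolding Let_def sum_eq by simp
qed

end
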